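(* Let $X$ be a simplicial complex and let $\mathrm{Co}_k : C_k(X)\to C_{k+1}(X)$, $k\ge 0$, be a simplicial cone operator with contraction vertex $a\in X^0$. For $k\ge 1$ let $P^k : C^k(X)\to C^{k-1}(X)$ be the associated discrete Poincaré operator, defined by $\langle P^k\alpha,\sigma\rangle = \langle \alpha, \mathrm{Co}_{k-1}(\sigma)\rangle$ for all $\alpha\in C^k(X)$ and $\sigma\in X^{k-1}$. Then $$(\mathsf d^{k-1}P^k + P^{k+1}\mathsf d^k)\alpha = \alpha \quad \text{for all } \alpha\in C^k(X),\ k\ge 1,$$ $$P^{1}\mathsf d^0\alpha = \alpha - \pi^*\alpha \quad \text{for all } \alpha\in C^0(X),$$ where $\pi^*\alpha\in C^0(X)$ is the cochain with $\langle \pi^*\alpha, v\rangle = \langle \alpha, a\rangle$ for every $v\in X^0$.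
   Context: $X$ is a geometric simplicial complex, $X^k$ is its set of $k$-simplices, $C_k(X)$ and $C^k(X)$ are the real vector spaces of simplicial $k$-chains and $k$-cochains, $\langle\cdot,\cdot\rangle$ is the pairing between cochains and chains, $\partial_k : C_k(X)\to C_{k-1}(X)$ is the boundary map and $\mathsf d^k : C^k(X)\to C^{k+1}(X)$ is the coboundary map, $\langle \mathsf d^k\alpha, c\rangle=\langle\alpha,\partial_{k+1}c\rangle$. A simplicial cone operator with contraction vertex $a\in X^0$ is a family of linear maps $\mathrm{Co}_k : C_k(X)\to C_{k+1}(X)$, $k\ge0$, such that $\mathrm{Co}_{k-1}(\partial_k\sigma)+\partial_{k+1}\mathrm{Co}_k(\sigma)=\sigma$ for all $\sigma\in X^k$, $k\ge 1$, and $\partial_1\mathrm{Co}_0(v)=v-a$ for all $v\in X^0$. *)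

theory Defs
  imports
    "HOL-Analysis.Analysis"
    "HOL-Combinatorics.Permutations"
    "HOL-Library.Poly_Mapping"
    "HOL-Library.Function_Algebras"
begin

section \<open>Geometric simplicial complexes\<close>

text \<open>These are the conditions of the library's \<^const>\<open>simplicial_complex\<close> except finiteness, which
  is not assumed here. As in the library, the empty face belongs to every nonempty complex; it is
  not a \<open>k\<close>-simplex for any \<open>k \<ge> 0\<close>.\<close>

definition geometric_complex :: "'a::euclidean_space set set \<Rightarrow> bool" where
  "geometric_complex X \<longleftrightarrow>
     (\<forall>S\<in>X. \<exists>n. n simplex S) \<and>
     (\<forall>F S. S \<in> X \<and> F face_of S \<longrightarrow> F \<in> X) \<and>
     (\<forall>S S'. S \<in> X \<and> S' \<in> X \<longrightarrow> (S \<inter> S') face_of S)"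

lemma simplicial_complex_iff_finite_geometric_complex:
  "simplicial_complex X \<longleftrightarrow> finite X \<and> geometric_complex X"
  by (simp add: simplicial_complex_def geometric_complex_def)

definition k_simplices :: "'a::euclidean_space set set \<Rightarrow> nat \<Rightarrow> 'a set set" where
  "k_simplices X k = {S \<in> X. int k simplex S}"

text \<open>An orientation is a choice, for every simplex, of an enumeration of its vertices. Only its
  class modulo even permutations matters below. It is arbitrary on each simplex, so no compatibility
  between a simplex and its faces is imposed. A vertex \<open>v\<close> is the simplex \<open>{v}\<close> and can only be
  enumerated as \<open>[v]\<close>.\<close>

definition orientation :: "'a::euclidean_space set set \<Rightarrow> ('a set \<Rightarrow> 'a list) \<Rightarrow> bool" where
  "orientation X ori \<longleftrightarrow>
     (\<forall>S\<in>X. distinct (ori S) \<and> set (ori S) = {v. v extreme_point_of S})"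


section \<open>Chains\<close>

text \<open>A chain is a finitely supported real combination of simplices; the generator
  \<^term>\<open>Poly_Mapping.single S 1\<close> stands for \<open>S\<close> with its chosen orientation.\<close>

instantiation poly_mapping :: (type, real_vector) real_vector
begin

lift_definition scaleR_poly_mapping :: "real \<Rightarrow> ('a \<Rightarrow>\<^sub>0 'b) \<Rightarrow> 'a \<Rightarrow>\<^sub>0 'b"
  is "\<lambda>r f x. r *\<^sub>R f x"
  by (rule finite_subset) auto

instance
  by standard (transfer; simp add: fun_eq_iff algebra_simps)+

end

type_synonym 'a chain = "'a set \<Rightarrow>\<^sub>0 real"

definition chains :: "'a::euclidean_space set set \<Rightarrow> nat \<Rightarrow> 'a chain set" where
  "chains X k = {c. Poly_Mapping.keys c \<subseteq> k_simplices X k}"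

lemma subspace_chains: "subspace (chains X k)"
proof -
  have "c + d \<in> chains X k" if "c \<in> chains X k" "d \<in> chains X k" for c d
    using that keys_add[of c d] by (auto simp: chains_def)
  moreover have "r *\<^sub>R c \<in> chains X k" if "c \<in> chains X k" for r c
    using that by (auto simp: chains_def in_keys_iff scaleR_poly_mapping.rep_eq subset_eq)
  ultimately show ?thesis
    by (auto simp: subspace_def chains_def)
qed

text \<open>The oriented simplex \<open>[w\<^sub>0, \<dots>, w\<^sub>k]\<close>, with the sign comparing the given order of its vertices to
  the chosen one.\<close>

definition oriented_simplex :: "('a set \<Rightarrow> 'a list) \<Rightarrow> 'a::euclidean_space list \<Rightarrow> 'a chain" where
  "oriented_simplex ori ws =
     (let S = convex hull (set ws) in
      Poly_Mapping.single S
        (of_int (sign (THE p. p permutes {..<length ws} \<and> permute_list p (ori S) = ws))))"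

text \<open>\<open>\<partial>\<^sub>k[v\<^sub>0, \<dots>, v\<^sub>k] = \<Sum>\<^sub>i (-1)\<^sup>i [v\<^sub>0, \<dots>, v\<^sub>i\<^sub>-\<^sub>1, v\<^sub>i\<^sub>+\<^sub>1, \<dots>, v\<^sub>k]\<close>, extended linearly, with \<open>\<partial>\<^sub>0 = 0\<close>.\<close>

definition boundary :: "('a set \<Rightarrow> 'a list) \<Rightarrow> nat \<Rightarrow> 'a::euclidean_space chain \<Rightarrow> 'a chain" where
  "boundary ori k c =
     (if k = 0 then 0
      else \<Sum>S\<in>Poly_Mapping.keys c. Poly_Mapping.lookup c S *\<^sub>R
             (\<Sum>i\<le>k. (-1) ^ i *\<^sub>R oriented_simplex ori (take i (ori S) @ drop (Suc i) (ori S))))"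


section \<open>Cochains\<close>

text \<open>A cochain is given by its values on the (oriented) simplices; it need not have finite support.
  The value is set to 0 off the \<open>k\<close>-simplices so that equality of cochains is equality of functions.\<close>

type_synonym 'a cochain = "'a set \<Rightarrow> real"

definition cochains :: "'a::euclidean_space set set \<Rightarrow> nat \<Rightarrow> 'a cochain set" where
  "cochains X k = {\<alpha>. \<forall>S. S \<notin> k_simplices X k \<longrightarrow> \<alpha> S = 0}"

definition pairing :: "'a cochain \<Rightarrow> 'a chain \<Rightarrow> real" where
  "pairing \<alpha> c = (\<Sum>S\<in>Poly_Mapping.keys c. \<alpha> S * Poly_Mapping.lookup c S)"

definition coboundary ::
    "'a::euclidean_space set set \<Rightarrow> ('a set \<Rightarrow> 'a list) \<Rightarrow> nat \<Rightarrow> 'a cochain \<Rightarrow> 'a cochain" where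
  "coboundary X ori k \<alpha> =
     (\<lambda>S. if S \<in> k_simplices X (k + 1)
          then pairing \<alpha> (boundary ori (k + 1) (Poly_Mapping.single S 1)) else 0)"

lemma coboundary_in_cochains: "coboundary X ori k \<alpha> \<in> cochains X (k + 1)"
  by (simp add: coboundary_def cochains_def)

lemma pairing_superset:
  assumes "finite A" "Poly_Mapping.keys c \<subseteq> A"
  shows "pairing \<alpha> c = (\<Sum>S\<in>A. \<alpha> S * Poly_Mapping.lookup c S)"
  unfolding pairing_def using assms
  by (intro sum.mono_neutral_left) (auto simp: in_keys_iff)

lemma linear_pairing: "linear (pairing \<alpha>)"
proof
  fix c d :: "'a chain" and r :: real
  let ?A = "Poly_Mapping.keys c \<union> Poly_Mapping.keys d"
  have "pairing \<alpha> (c + d) = (\<Sum>S\<in>?A. \<alpha> S * Poly_Mapping.lookup (c + d) S)"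
    using keys_add[of c d] by (intro pairing_superset) auto
  also have "\<dots> = pairing \<alpha> c + pairing \<alpha> d"
    by (simp add: pairing_superset[of ?A c] pairing_superset[of ?A d] lookup_add algebra_simps
        sum.distrib)
  finally show "pairing \<alpha> (c + d) = pairing \<alpha> c + pairing \<alpha> d" .
  have "pairing \<alpha> (r *\<^sub>R c) =
      (\<Sum>S\<in>Poly_Mapping.keys c. \<alpha> S * Poly_Mapping.lookup (r *\<^sub>R c) S)"
    by (intro pairing_superset) (auto simp: in_keys_iff scaleR_poly_mapping.rep_eq)
  then show "pairing \<alpha> (r *\<^sub>R c) = r *\<^sub>R pairing \<alpha> c"
    by (simp add: pairing_def scaleR_poly_mapping.rep_eq sum_distrib_left algebra_simps)
qed

lemma pairing_single [simp]: "pairing \<alpha> (Poly_Mapping.single S r) = r * \<alpha> S"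
  by (simp add: pairing_def)

text \<open>The defining duality of the coboundary holds for all chains.\<close>

lemma pairing_coboundary:
  assumes "c \<in> chains X (k + 1)"
  shows "pairing (coboundary X ori k \<alpha>) c = pairing \<alpha> (boundary ori (k + 1) c)"
proof -
  let ?b = "\<lambda>S. \<Sum>i\<le>k + 1. (-1) ^ i *\<^sub>R
              oriented_simplex ori (take i (ori S) @ drop (Suc i) (ori S))"
  have gen: "boundary ori (k + 1) (Poly_Mapping.single S 1) = ?b S" for S
    by (simp add: boundary_def)
  have "pairing \<alpha> (boundary ori (k + 1) c) =
      pairing \<alpha> (\<Sum>S\<in>Poly_Mapping.keys c. Poly_Mapping.lookup c S *\<^sub>R ?b S)"
    by (simp add: boundary_def)
  also have "\<dots> = (\<Sum>S\<in>Poly_Mapping.keys c. Poly_Mapping.lookup c S * pairing \<alpha> (?b S))"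
    by (simp only: linear_sum[OF linear_pairing] linear_cmul[OF linear_pairing] real_scaleR_def)
  also have "\<dots> = pairing (coboundary X ori k \<alpha>) c"
    unfolding pairing_def[of _ c] using assms
    by (intro sum.cong)
      (auto simp: coboundary_def chains_def gen[unfolded Suc_eq_plus1[symmetric]] mult.commute
        simp del: sum.atMost_Suc)
  finally show ?thesis ..
qed


section \<open>Cone operators and discrete Poincare operators\<close>

definition linear_between ::
    "'v::real_vector set \<Rightarrow> 'w::real_vector set \<Rightarrow> ('v \<Rightarrow> 'w) \<Rightarrow> bool" where
  "linear_between V W f \<longleftrightarrow>
     f \<in> V \<rightarrow> W \<and>
     (\<forall>x\<in>V. \<forall>y\<in>V. f (x + y) = f x + f y) \<and>
     (\<forall>r. \<forall>x\<in>V. f (r *\<^sub>R x) = r *\<^sub>R f x)"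

definition simplicial_cone_operator ::
    "'a::euclidean_space set set \<Rightarrow> ('a set \<Rightarrow> 'a list) \<Rightarrow> 'a \<Rightarrow> (nat \<Rightarrow> 'a chain \<Rightarrow> 'a chain) \<Rightarrow> bool"
  where
  "simplicial_cone_operator X ori a Co \<longleftrightarrow>
     {a} \<in> k_simplices X 0 \<and>
     (\<forall>k. linear_between (chains X k) (chains X (k + 1)) (Co k)) \<and>
     (\<forall>k\<ge>1. \<forall>S\<in>k_simplices X k.
        Co (k - 1) (boundary ori k (Poly_Mapping.single S 1)) +
        boundary ori (k + 1) (Co k (Poly_Mapping.single S 1)) = Poly_Mapping.single S 1) \<and>
     (\<forall>v. {v} \<in> k_simplices X 0 \<longrightarrow>
        boundary ori 1 (Co 0 (Poly_Mapping.single {v} 1)) =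
        Poly_Mapping.single {v} 1 - Poly_Mapping.single {a} 1)"

text \<open>The operator \<open>P\<^sup>k\<close>, for \<open>k \<ge> 1\<close>.\<close>

definition discrete_poincare ::
    "'a::euclidean_space set set \<Rightarrow> (nat \<Rightarrow> 'a chain \<Rightarrow> 'a chain) \<Rightarrow> nat \<Rightarrow> 'a cochain \<Rightarrow> 'a cochain"
  where
  "discrete_poincare X Co k \<alpha> =
     (\<lambda>S. if S \<in> k_simplices X (k - 1)
          then pairing \<alpha> (Co (k - 1) (Poly_Mapping.single S 1)) else 0)"

lemma discrete_poincare_in_cochains: "discrete_poincare X Co k \<alpha> \<in> cochains X (k - 1)"
  by (simp add: discrete_poincare_def cochains_def)

lemma pairing_discrete_poincare:
  assumes "S \<in> k_simplices X (k - 1)"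
  shows "pairing (discrete_poincare X Co k \<alpha>) (Poly_Mapping.single S 1) =
         pairing \<alpha> (Co (k - 1) (Poly_Mapping.single S 1))"
  using assms by (simp add: discrete_poincare_def)

definition vertex_pullback :: "'a::euclidean_space set set \<Rightarrow> 'a \<Rightarrow> 'a cochain \<Rightarrow> 'a cochain" where
  "vertex_pullback X a \<alpha> =
     (\<lambda>S. if S \<in> k_simplices X 0 then pairing \<alpha> (Poly_Mapping.single {a} 1) else 0)"

end

theory Submission
  imports Defs
begin

text \<open>The formula defining \<open>P\<^sup>k\<close> on simplices extends linearly to all chains, so \<open>P\<^sup>k\<close> is the
  transpose of \<open>Co\<close> as \<open>d\<close> is the transpose of \<open>\<partial>\<close>. Paired with a simplex \<open>S\<close>,
  \<open>d P \<alpha> + P d \<alpha>\<close> is therefore \<open>\<alpha>\<close> paired with \<open>Co \<partial>S + \<partial> Co S\<close>, which is \<open>S\<close>, or \<open>S - a\<close> without the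
  first summand in degree \<open>0\<close>. The extension to chains is applied to \<open>\<partial>S\<close>, which has to be supported
  on simplices of \<open>X\<close>: this is where closure of \<open>X\<close> under faces enters.\<close>

text \<open>\<open>linear_between\<close> speaks of \<open>f\<close> on \<open>V\<close> only, so
  the induction has to keep every partial sum inside the subspace \<open>V\<close> before additivity
  may be applied.\<close>

lemma linear_between_sum:
  assumes "linear_between V W f" "subspace V" "\<And>i. i \<in> I \<Longrightarrow> x i \<in> V"
  shows "f (\<Sum>i\<in>I. r i *\<^sub>R x i) = (\<Sum>i\<in>I. r i *\<^sub>R f (x i))"
proof -
  \<comment> \<open>Settles the empty index set and also an infinite one, over which a sum is 0 by
    convention.\<close>
  have f0: "f 0 = 0"
    using assms(1) subspace_0[OF assms(2)] unfolding linear_between_def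
    by (metis scale_zero_left)
  show ?thesis
    using assms(3)
  proof (induction I rule: infinite_finite_induct)
    case (insert i I)
    have "r i *\<^sub>R x i \<in> V" "(\<Sum>i\<in>I. r i *\<^sub>R x i) \<in> V" "x i \<in> V"
      using insert.prems by (auto intro!: subspace_scale[OF assms(2)] subspace_sum[OF assms(2)])
    then show ?case
      using insert assms(1) by (simp add: linear_between_def)
  qed (simp_all add: f0)
qed

lemma scaleR_single: "r *\<^sub>R Poly_Mapping.single S s = Poly_Mapping.single S (r *\<^sub>R s)"
  by transfer (auto simp: when_def)

lemma chain_eq_sum_single:
  "c = (\<Sum>S\<in>Poly_Mapping.keys c. Poly_Mapping.lookup c S *\<^sub>R Poly_Mapping.single S (1::real))"
  by (intro poly_mapping_eqI)
    (simp add: lookup_sum scaleR_single lookup_single when_def in_keys_iff)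

lemma single_in_chains: "S \<in> k_simplices X k \<Longrightarrow> Poly_Mapping.single S r \<in> chains X k"
  by (auto simp: chains_def)

lemma pairing_discrete_poincare_chain:
  assumes Co: "linear_between (chains X k) W (Co k)" and c: "c \<in> chains X k"
  shows "pairing (discrete_poincare X Co (k + 1) \<alpha>) c = pairing \<alpha> (Co k c)"
proof -
  have keys: "S \<in> k_simplices X k" if "S \<in> Poly_Mapping.keys c" for S
    using that c by (auto simp: chains_def)
  have "Co k c = Co k (\<Sum>S\<in>Poly_Mapping.keys c.
      Poly_Mapping.lookup c S *\<^sub>R Poly_Mapping.single S 1)"
    using chain_eq_sum_single[of c] by simp
  also have "\<dots> = (\<Sum>S\<in>Poly_Mapping.keys c.
      Poly_Mapping.lookup c S *\<^sub>R Co k (Poly_Mapping.single S 1))"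
    using keys by (intro linear_between_sum[OF Co subspace_chains] single_in_chains)
  finally have "pairing \<alpha> (Co k c) = (\<Sum>S\<in>Poly_Mapping.keys c.
      Poly_Mapping.lookup c S * pairing \<alpha> (Co k (Poly_Mapping.single S 1)))"
    by (simp only: linear_sum[OF linear_pairing] linear_cmul[OF linear_pairing] real_scaleR_def)
  also have "\<dots> = pairing (discrete_poincare X Co (k + 1) \<alpha>) c"
    unfolding pairing_def[of _ c] using keys
    by (intro sum.cong) (auto simp: discrete_poincare_def mult.commute)
  finally show ?thesis ..
qed

text \<open>Deleting one of \<open>k + 2\<close> affinely independent vertices leaves
  \<open>k + 1\<close> affinely independent points, and their hull is a face of \<open>S\<close>,
  hence in \<open>X\<close>.\<close>

lemma facet_in_k_simplices:
  assumes X: "geometric_complex X" and ori: "orientation X ori"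
    and S: "S \<in> k_simplices X (Suc k)" and i: "i \<le> Suc k"
  shows "convex hull (set (take i (ori S) @ drop (Suc i) (ori S))) \<in> k_simplices X k"
proof -
  have SX: "S \<in> X" and "int (Suc k) simplex S"
    using S by (auto simp: k_simplices_def)
  then obtain C where C: "\<not> affine_dependent C" "int (card C) = int (Suc k) + 1" "S = convex hull C"
    by (auto simp: simplex_def)
  \<comment> \<open>The extreme points of the hull of an affinely independent set are exactly its
    points, so \<open>ori S\<close> enumerates \<open>C\<close>.\<close>
  have dist: "distinct (ori S)" and set: "set (ori S) = C"
    using ori SX C extreme_point_of_convex_hull_affine_independent[OF C(1)]
    by (auto simp: orientation_def)
  have len: "length (ori S) = k + 2"
    using distinct_card[OF dist] set C(2) by simp
  \<comment> \<open>With the deleted entry put back, distinctness shows that the shortened list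
    misses precisely that one vertex.\<close>
  have "distinct (take i (ori S) @ ori S ! i # drop (Suc i) (ori S))"
    "set (take i (ori S) @ ori S ! i # drop (Suc i) (ori S)) = C"
    using id_take_nth_drop[of i "ori S"] dist set len i by auto
  then have facet: "set (take i (ori S) @ drop (Suc i) (ori S)) = C - {ori S ! i}"
    and "ori S ! i \<in> C"
    by auto
  then have card: "card (C - {ori S ! i}) = k + 1"
    using C(2) by simp
  have "convex hull (C - {ori S ! i}) face_of S"
    unfolding C(3) using face_of_convex_hull_affine_independent[OF C(1)] by blast
  then have "convex hull (C - {ori S ! i}) \<in> X"
    using X SX unfolding geometric_complex_def by blast
  moreover have "int k simplex (convex hull (C - {ori S ! i}))"
    unfolding simplex_def using card affine_independent_Diff[OF C(1)]
    by (intro exI[of _ "C - {ori S ! i}"]) auto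
  ultimately show ?thesis
    unfolding facet by (simp add: k_simplices_def)
qed

lemma boundary_single_in_chains:
  assumes "geometric_complex X" "orientation X ori" "S \<in> k_simplices X (Suc k)"
  shows "boundary ori (Suc k) (Poly_Mapping.single S 1) \<in> chains X k"
proof -
  have "(\<Sum>i\<le>Suc k. (-1) ^ i *\<^sub>R oriented_simplex ori (take i (ori S) @ drop (Suc i) (ori S)))
      \<in> chains X k"
    \<comment> \<open>Membership depends on the support alone and \<open>single_in_chains\<close>
      admits any coefficient, so the sign is never evaluated.\<close>
    unfolding oriented_simplex_def Let_def
    by (intro subspace_sum[OF subspace_chains] subspace_scale[OF subspace_chains]
        single_in_chains facet_in_k_simplices[OF assms]) simp
  then show ?thesis
    by (simp add: boundary_def del: sum.atMost_Suc)
qed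

text \<open>\<open>Co k\<close> maps into chains of \<open>X\<close>, so the duality of
  \<open>coboundary\<close> applies to the image of \<open>S\<close>. Valid for every
  \<open>k\<close>, including 0, this supplies the summand \<open>P d\<close> of both
  formulas.\<close>

lemma discrete_poincare_coboundary:
  assumes Co: "linear_between (chains X k) (chains X (k + 1)) (Co k)" and S: "S \<in> k_simplices X k"
  shows "discrete_poincare X Co (k + 1) (coboundary X ori k \<alpha>) S =
    pairing \<alpha> (boundary ori (k + 1) (Co k (Poly_Mapping.single S 1)))"
proof -
  have "Co k (Poly_Mapping.single S 1) \<in> chains X (k + 1)"
    using Co single_in_chains[OF S] by (auto simp: linear_between_def)
  then show ?thesis
    using S pairing_coboundary[of _ X k ori \<alpha>] by (simp add: discrete_poincare_def)
qed

lemma poincare_homotopy_formula: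
  assumes X: "geometric_complex X" and ori: "orientation X ori"
    and Co: "simplicial_cone_operator X ori a Co" and \<alpha>: "\<alpha> \<in> cochains X (Suc k)"
  shows "coboundary X ori k (discrete_poincare X Co (k + 1) \<alpha>) +
    discrete_poincare X Co (Suc k + 1) (coboundary X ori (Suc k) \<alpha>) = \<alpha>"
proof
  fix S
  have lin: "linear_between (chains X j) (chains X (j + 1)) (Co j)" for j
    using Co unfolding simplicial_cone_operator_def by blast
  let ?S = "Poly_Mapping.single S 1 :: 'a chain"
  show "(coboundary X ori k (discrete_poincare X Co (k + 1) \<alpha>) +
    discrete_poincare X Co (Suc k + 1) (coboundary X ori (Suc k) \<alpha>)) S = \<alpha> S"
  proof (cases "S \<in> k_simplices X (Suc k)")
    case True
    have cone: "Co k (boundary ori (Suc k) ?S) + boundary ori (Suc k + 1) (Co (Suc k) ?S) = ?S"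
      using Co True unfolding simplicial_cone_operator_def
      by (metis One_nat_def Suc_le_mono diff_Suc_1 le0)
    have "coboundary X ori k (discrete_poincare X Co (k + 1) \<alpha>) S =
        pairing \<alpha> (Co k (boundary ori (Suc k) ?S))"
      using True pairing_discrete_poincare_chain[where Co = Co, OF lin boundary_single_in_chains[OF X ori True], of \<alpha>]
      by (simp add: coboundary_def)
    then have "(coboundary X ori k (discrete_poincare X Co (k + 1) \<alpha>) +
        discrete_poincare X Co (Suc k + 1) (coboundary X ori (Suc k) \<alpha>)) S =
        pairing \<alpha> (Co k (boundary ori (Suc k) ?S) + boundary ori (Suc k + 1) (Co (Suc k) ?S))"
      unfolding plus_fun_apply discrete_poincare_coboundary[where Co = Co, OF lin True]
      by (simp only: linear_add[OF linear_pairing])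
    then show ?thesis
      by (simp only: cone pairing_single mult_1)
  next
    \<comment> \<open>Here the left side is 0 by the default values of both operators, and \<alpha>
      is 0 because it is a cochain.\<close>
    case False
    then show ?thesis
      using \<alpha> by (simp add: coboundary_def discrete_poincare_def cochains_def)
  qed
qed

lemma poincare_homotopy_formula_0:
  assumes Co: "simplicial_cone_operator X ori a Co" and \<alpha>: "\<alpha> \<in> cochains X 0"
  shows "discrete_poincare X Co 1 (coboundary X ori 0 \<alpha>) = \<alpha> - vertex_pullback X a \<alpha>"
proof
  fix S
  have lin: "linear_between (chains X 0) (chains X (0 + 1)) (Co 0)"
    using Co unfolding simplicial_cone_operator_def by blast
  show "discrete_poincare X Co 1 (coboundary X ori 0 \<alpha>) S = (\<alpha> - vertex_pullback X a \<alpha>) S"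
  proof (cases "S \<in> k_simplices X 0")
    case True
    \<comment> \<open>The cone identity in degree 0 is stated for vertices, so \<open>S\<close> must
      first be written as a singleton.\<close>
    then obtain v where v: "S = {v}"
      by (auto simp: k_simplices_def simplex_zero)
    have "boundary ori 1 (Co 0 (Poly_Mapping.single S 1)) =
        Poly_Mapping.single S 1 - Poly_Mapping.single {a} 1"
      using Co True unfolding v simplicial_cone_operator_def by blast
    then show ?thesis
      using True discrete_poincare_coboundary[where Co = Co, OF lin True, of ori \<alpha>]
      by (simp add: linear_diff[OF linear_pairing] vertex_pullback_def)
  next
    case False
    then show ?thesis
      using \<alpha> by (simp add: discrete_poincare_def vertex_pullback_def cochains_def)
  qed
qed

theorem proposition3p5:
  fixes X :: "'a::euclidean_space set set"
    and ori :: "'a set \<Rightarrow> 'a list"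
    and a :: 'a
    and Co :: "nat \<Rightarrow> 'a chain \<Rightarrow> 'a chain"
  assumes "geometric_complex X"
    and "orientation X ori"
    and "simplicial_cone_operator X ori a Co"
  shows "(\<forall>k\<ge>1. \<forall>\<alpha>\<in>cochains X k.
            coboundary X ori (k - 1) (discrete_poincare X Co k \<alpha>) +
            discrete_poincare X Co (k + 1) (coboundary X ori k \<alpha>) = \<alpha>) \<and>
         (\<forall>\<alpha>\<in>cochains X 0.
            discrete_poincare X Co 1 (coboundary X ori 0 \<alpha>) = \<alpha> - vertex_pullback X a \<alpha>)"
proof (intro conjI allI impI ballI)
  fix k :: nat and \<alpha> assume k: "1 \<le> k" and \<alpha>: "\<alpha> \<in> cochains X k"
  \<comment> \<open>Replaces the truncated difference \<open>k - 1\<close> by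
    \<open>j\<close>.\<close>
  obtain j where "k = Suc j"
    using k by (cases k) auto
  then show "coboundary X ori (k - 1) (discrete_poincare X Co k \<alpha>) +
      discrete_poincare X Co (k + 1) (coboundary X ori k \<alpha>) = \<alpha>"
    using poincare_homotopy_formula[OF assms, of \<alpha> j] \<alpha> by simp
qed (rule poincare_homotopy_formula_0[OF assms(3)])

end
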